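(* Let $\omega\in(0,\tfrac18)$, let $P^0$ be an initial polygon and $P^{k+1}=S_{\mathrm H}(P^k)$, where $S_{\mathrm H}$ is the Heisenberg four-point subdivision operator and $P^k=\{(x_i^k,y_i^k,z_i^k)\}_{i\in\mathbb{Z}}$. Write $d_i^k:=z_{i+1}^k-z_i^k$. Then for all $i\in\mathbb{Z}$ and all $k\ge0$, $$d_{2i}^{k+1}=R_i^k+\tfrac12d_i^k-\omega d_{i+1}^k+\omega d_{i-1}^k,$$ $$d_{2i+1}^{k+1}=-R_i^k+\tfrac12d_i^k+\omega d_{i+1}^k-\omega d_{i-1}^k.$$ Equivalently, with $e_i^k=2^kd_i^k$ and $F_i^k=2^kR_i^k$, $$e^{k+1}=S\,e^k+\hat g^{k+1},\qquad \hat g^{k+1}_{2i}=2F_i^k,\quad \hat g^{k+1}_{2i+1}=-2F_i^k,$$ where $S$ is the scaled derived operator $$(Se)_{2i}=2\omega e_{i-1}+e_i-2\omega e_{i+1},\qquad (Se)_{2i+1}=-2\omega e_{i-1}+e_i+2\omega e_{i+1}.$$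
   Context: For a real sequence $u=\{u_i\}_{i\in\mathbb{Z}}$ the four-point operator $L_4$ with parameter $\omega$ is $(L_4u)_{2i}=u_i$, $(L_4u)_{2i+1}=-\omega u_{i-1}+(\tfrac12+\omega)u_i+(\tfrac12+\omega)u_{i+1}-\omega u_{i+2}$. The Heisenberg four-point subdivision operator $S_{\mathrm H}$ maps $P^k=\{(x_i^k,y_i^k,z_i^k)\}_{i\in\mathbb{Z}}\subset\mathbb{R}^3$ to $P^{k+1}$ defined by $P^{k+1}_{2i}=P^k_i$ and $P^{k+1}_{2i+1}=(X_{2i+1},Y_{2i+1},Z_{2i+1})$ with $X_{2i+1}=(L_4x^k)_{2i+1}$, $Y_{2i+1}=(L_4y^k)_{2i+1}$, $Z_{2i+1}=(L_4z^k)_{2i+1}+R_i^k$, where $R_i^k=\tfrac12(x_i^kb_i^k-y_i^ka_i^k)$, $a_i^k=X_{2i+1}-x_i^k$, $b_i^k=Y_{2i+1}-y_i^k$. *)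

theory Defs imports Complex_Main begin

text \<open>The bi-infinite sequence with entries \<open>f i\<close> at index \<open>2i\<close> and \<open>g i\<close> at index \<open>2i+1\<close>.
  On \<open>int\<close>, \<open>div\<close> rounds down, so this also holds for negative \<open>i\<close>.\<close>

definition interleave :: "(int \<Rightarrow> 'a) \<Rightarrow> (int \<Rightarrow> 'a) \<Rightarrow> int \<Rightarrow> 'a" where
  "interleave f g j = (if even j then f (j div 2) else g (j div 2))"

lemma interleave_even [simp]: "interleave f g (2 * i) = f i"
  by (simp add: interleave_def)

lemma interleave_odd [simp]: "interleave f g (2 * i + 1) = g i"
  by (simp add: interleave_def)

definition four_point :: "real \<Rightarrow> (int \<Rightarrow> real) \<Rightarrow> int \<Rightarrow> real" where
  "four_point \<omega> u = interleave u
     (\<lambda>i. - \<omega> * u (i - 1) + (1/2 + \<omega>) * u i + (1/2 + \<omega>) * u (i + 1) - \<omega> * u (i + 2))"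

type_synonym polygon = "int \<Rightarrow> real \<times> real \<times> real"

definition xc :: "polygon \<Rightarrow> int \<Rightarrow> real" where "xc P i = fst (P i)"
definition yc :: "polygon \<Rightarrow> int \<Rightarrow> real" where "yc P i = fst (snd (P i))"
definition zc :: "polygon \<Rightarrow> int \<Rightarrow> real" where "zc P i = snd (snd (P i))"

definition heis_R :: "real \<Rightarrow> polygon \<Rightarrow> int \<Rightarrow> real" where
  "heis_R \<omega> P i =
     (let a = four_point \<omega> (xc P) (2 * i + 1) - xc P i;
          b = four_point \<omega> (yc P) (2 * i + 1) - yc P i
      in 1/2 * (xc P i * b - yc P i * a))"

definition heis_subdiv :: "real \<Rightarrow> polygon \<Rightarrow> polygon" where
  "heis_subdiv \<omega> P = interleave P
     (\<lambda>i. (four_point \<omega> (xc P) (2 * i + 1),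
           four_point \<omega> (yc P) (2 * i + 1),
           four_point \<omega> (zc P) (2 * i + 1) + heis_R \<omega> P i))"

definition scaled_derived :: "real \<Rightarrow> (int \<Rightarrow> real) \<Rightarrow> int \<Rightarrow> real" where
  "scaled_derived \<omega> e = interleave
     (\<lambda>i. 2 * \<omega> * e (i - 1) + e i - 2 * \<omega> * e (i + 1))
     (\<lambda>i. - 2 * \<omega> * e (i - 1) + e i + 2 * \<omega> * e (i + 1))"

end

theory Submission imports Defs begin

text \<open>
  The Heisenberg correction \<open>R\<close> enters the vertical coordinate only at the inserted points. An
  inserted point lies between two retained ones, so the correction is gained on the edge entering
  it and lost again on the edge leaving it: this is where the opposite signs of \<open>R\<close> come from.
  What is left is the four-point rule applied to \<open>z\<close>. Its weights sum to \<open>1\<close>, so on each of the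
  two new edges its contribution is a linear functional of \<open>z\<close> that annihilates constants, hence
  a combination of first differences. Half the old difference comes from midpoint insertion; the
  part with factor \<open>\<omega>\<close> is, up to sign,
  \<open>(z\<^bsub>i\<^esub> - z\<^bsub>i-1\<^esub>) - (z\<^bsub>i+2\<^esub> - z\<^bsub>i+1\<^esub>)\<close>, in which the difference along the split edge itself
  does not occur. Multiplying by \<open>2 ^ (k + 1)\<close>, where one factor \<open>2\<close> cancels the \<open>1/2\<close>, gives
  the rescaled form.
\<close>

lemma zc_increment_heis_subdiv_even:
  "zc (heis_subdiv \<omega> P) (2 * i + 1) - zc (heis_subdiv \<omega> P) (2 * i)
     = heis_R \<omega> P i + 1/2 * (zc P (i + 1) - zc P i)
       - \<omega> * (zc P (i + 2) - zc P (i + 1)) + \<omega> * (zc P i - zc P (i - 1))"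
proof -
  have "zc (heis_subdiv \<omega> P) (2 * i) = zc P i"
    by (simp add: heis_subdiv_def zc_def)
  moreover have "zc (heis_subdiv \<omega> P) (2 * i + 1)
      = four_point \<omega> (zc P) (2 * i + 1) + heis_R \<omega> P i"
    unfolding heis_subdiv_def zc_def[of "interleave _ _"] by simp
  ultimately show ?thesis
    unfolding four_point_def interleave_odd by (simp add: algebra_simps)
qed

text \<open>
  The edge from \<open>z\<^bsub>i\<^esub>\<close> to \<open>z\<^bsub>i+1\<^esub>\<close> is split in two, so this increment and the preceding one
  add up to \<open>z\<^bsub>i+1\<^esub> - z\<^bsub>i\<^esub>\<close>; all terms except the halved one therefore change sign.
\<close>

lemma zc_increment_heis_subdiv_odd:
  "zc (heis_subdiv \<omega> P) (2 * i + 2) - zc (heis_subdiv \<omega> P) (2 * i + 1)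
     = - heis_R \<omega> P i + 1/2 * (zc P (i + 1) - zc P i)
       + \<omega> * (zc P (i + 2) - zc P (i + 1)) - \<omega> * (zc P i - zc P (i - 1))"
proof -
  have retained: "zc (heis_subdiv \<omega> P) (2 * j) = zc P j" for j
    by (simp add: heis_subdiv_def zc_def)
  have "zc (heis_subdiv \<omega> P) (2 * i + 2) = zc P (i + 1)"
    using retained[of "i + 1"] by (simp add: algebra_simps)
  then show ?thesis
    using zc_increment_heis_subdiv_even[of \<omega> P i] retained[of i]
    by (simp add: algebra_simps)
qed

theorem proposition5p2:
  fixes \<omega> :: real and P :: "nat \<Rightarrow> polygon"
    and R d e F g :: "nat \<Rightarrow> int \<Rightarrow> real"
  assumes "0 < \<omega>" and "\<omega> < 1/8"
    and P_step: "\<And>k. P (Suc k) = heis_subdiv \<omega> (P k)"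
    and R_eq: "\<And>k i. R k i = heis_R \<omega> (P k) i"
    and d_eq: "\<And>k i. d k i = zc (P k) (i + 1) - zc (P k) i"
    and e_eq: "\<And>k i. e k i = 2 ^ k * d k i"
    and F_eq: "\<And>k i. F k i = 2 ^ k * R k i"
    and g_even: "\<And>k i. g (Suc k) (2 * i) = 2 * F k i"
    and g_odd: "\<And>k i. g (Suc k) (2 * i + 1) = - 2 * F k i"
  shows "(\<forall>k i. d (Suc k) (2 * i) = R k i + 1/2 * d k i - \<omega> * d k (i + 1) + \<omega> * d k (i - 1)
              \<and> d (Suc k) (2 * i + 1) = - R k i + 1/2 * d k i + \<omega> * d k (i + 1) - \<omega> * d k (i - 1))
       \<and> (\<forall>k. e (Suc k) = (\<lambda>j. scaled_derived \<omega> (e k) j + g (Suc k) j))"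
proof -
  have d_even: "d (Suc k) (2 * i)
      = R k i + 1/2 * d k i - \<omega> * d k (i + 1) + \<omega> * d k (i - 1)" for k i
    using zc_increment_heis_subdiv_even[of \<omega> "P k" i]
    by (simp add: d_eq R_eq P_step add.assoc)
  have d_odd: "d (Suc k) (2 * i + 1)
      = - R k i + 1/2 * d k i + \<omega> * d k (i + 1) - \<omega> * d k (i - 1)" for k i
    using zc_increment_heis_subdiv_odd[of \<omega> "P k" i]
    by (simp add: d_eq R_eq P_step add.assoc)
  have "e (Suc k) j = scaled_derived \<omega> (e k) j + g (Suc k) j" for k j
  proof (cases "even j")
    case True
    then obtain i where j: "j = 2 * i" by blast
    show ?thesis
      unfolding j scaled_derived_def interleave_even g_even e_eq F_eq d_even
      by (simp add: algebra_simps)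
  next
    case False
    then obtain i where j: "j = 2 * i + 1" by (rule oddE)
    show ?thesis
      unfolding j scaled_derived_def interleave_odd g_odd e_eq F_eq d_odd
      by (simp add: algebra_simps)
  qed
  with d_even d_odd show ?thesis by blast
qed

end
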